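(* Let $x^*$ be the unique root of $p(x) = 8x^3 - 22x^2 + 10x - 1$ in $[0,1/6]$, and let $H$ be a 3-uniform hypergraph with $v(H) \geq 5$ and $\delta_2^{\mathrm{ess}}(H) \geq (1 - x^* )\, v(H)$. Then $w_H(O) \geq 0$ for every ordered triple $O=(x_1,x_2,x_3)$ of distinct vertices with $\{x_1,x_2,x_3\}\in E(H)$. In particular, $w_H$ is a perfect fractional Steiner triple system of $H$.
   Context: Let $H$ be a 3-uniform hypergraph, $v(H)=|V(H)|$. For a pair $p$ of vertices, $N(p)=\{v: p\cup\{v\}\in E(H)\}$ and $\deg(p)=|N(p)|$; $\partial H$ is the graph of pairs with $\deg(p)>0$; $\delta_2^{\mathrm{ess}}(H)=\min\{\deg(p): \deg(p)>0\}$. For $\psi\colon E(H)\to\mathbb{R}$, $\deg^\psi(p)=\sum_{e\in E(H),\,p\subseteq e}\psi(e)$; a perfect fractional Steiner triple system of $H$ is a $\psi\colon E(H)\to[0,1]$ with $\deg^\psi(p)=1$ for all $p\in E(\partial H)$. For $r\in\{3,4,5\}$ an $r$-clique is an $r$-set of vertices all of whose 3-subsets are edges; for a vertex set $S$, $\mathcal{K}_r(H,S)$ is the set of $r$-cliques containing $S$. An ordered 5-clique is a 5-tuple $(v_1,\dots,v_5)$ of distinct vertices forming a 5-clique. For an ordered triple $O=(x_1,x_2,x_3)$, $\mathcal{OK}_5(H,O)$ is the set of ordered 5-cliques in which $x_1,x_2,x_3$ occur as a subsequence in this order; for an edge $e$, $\mathcal{OK}_5(H,e)$ is the set of ordered 5-cliques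 whose vertex set contains $e$. For $r\in\{2,3,4\}$, $W(v_1,\dots,v_r)=\prod_{i=2}^{r}1/|\mathcal{K}_{i+1}(H,\{v_1,\dots,v_i\})|$. For an ordered 5-clique $K=(v_1,\dots,v_5)$ and $e\in E(H)$, $\psi_K(e)=1/3$ if $e\subseteq\{v_1,\dots,v_5\}$ and $|e\cap\{v_1,v_2\}|\in\{0,2\}$, $\psi_K(e)=-1/6$ if $e\subseteq\{v_1,\dots,v_5\}$ and $|e\cap\{v_1,v_2\}|=1$, and $0$ otherwise. Define $w_H(e)=\frac12\sum_{K=(v_1,\dots,v_5)\in\mathcal{OK}_5(H,e)}W(v_1,\dots,v_4)\psi_K(e)$ for $e\in E(H)$, and for an ordered triple $O=(x_1,x_2,x_3)$ with $\{x_1,x_2,x_3\}\in E(H)$, $w_H(O)=\frac12\sum_{K=(v_1,\dots,v_5)\in\mathcal{OK}_5(H,O)}W(v_1,\dots,v_4)\psi_K(\{x_1,x_2,x_3\})$ (so $w_H(e)$ is the sum of $w_H(O)$ over the six orderings $O$ of $e$). *)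

theory Defs
  imports Complex_Main "HOL-Library.Sublist"
begin

record 'a hypergraph =
  vertices :: "'a set"
  edges :: "'a set set"

definition three_uniform :: "'a hypergraph \<Rightarrow> bool" where
  "three_uniform H \<longleftrightarrow>
     finite (vertices H) \<and> (\<forall>e\<in>edges H. e \<subseteq> vertices H \<and> card e = 3)"

definition nbhd :: "'a hypergraph \<Rightarrow> 'a set \<Rightarrow> 'a set" where
  "nbhd H p = {v. p \<union> {v} \<in> edges H}"

definition codeg :: "'a hypergraph \<Rightarrow> 'a set \<Rightarrow> nat" where
  "codeg H p = card (nbhd H p)"

definition shadow :: "'a hypergraph \<Rightarrow> 'a set set" where
  "shadow H = {p. p \<subseteq> vertices H \<and> card p = 2 \<and> codeg H p > 0}"

text \<open>If \<open>H\<close> has no edges, this is \<open>Min {}\<close>, an unspecified number.\<close>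
definition min_ess_codeg :: "'a hypergraph \<Rightarrow> nat" where
  "min_ess_codeg H = Min (codeg H ` shadow H)"

definition weighted_codeg :: "'a hypergraph \<Rightarrow> ('a set \<Rightarrow> real) \<Rightarrow> 'a set \<Rightarrow> real" where
  "weighted_codeg H \<psi> p = (\<Sum>e\<in>{e\<in>edges H. p \<subseteq> e}. \<psi> e)"

definition perfect_fractional_STS :: "'a hypergraph \<Rightarrow> ('a set \<Rightarrow> real) \<Rightarrow> bool" where
  "perfect_fractional_STS H \<psi> \<longleftrightarrow>
     (\<forall>e\<in>edges H. \<psi> e \<in> {0..1}) \<and> (\<forall>p\<in>shadow H. weighted_codeg H \<psi> p = 1)"

definition clique :: "'a hypergraph \<Rightarrow> nat \<Rightarrow> 'a set \<Rightarrow> bool" where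
  "clique H r K \<longleftrightarrow>
     K \<subseteq> vertices H \<and> card K = r \<and> (\<forall>e. e \<subseteq> K \<and> card e = 3 \<longrightarrow> e \<in> edges H)"

definition cliques_containing :: "'a hypergraph \<Rightarrow> nat \<Rightarrow> 'a set \<Rightarrow> 'a set set" where
  "cliques_containing H r S = {K. clique H r K \<and> S \<subseteq> K}"

text \<open>Ordered 5-cliques \<open>(v\<^sub>1, \<dots>, v\<^sub>5)\<close> are lists, so \<open>v\<^sub>i\<close> is \<open>vs ! (i - 1)\<close>.\<close>
definition ordered_5cliques :: "'a hypergraph \<Rightarrow> 'a list set" where
  "ordered_5cliques H = {vs. length vs = 5 \<and> distinct vs \<and> clique H 5 (set vs)}"

definition OK5_triple :: "'a hypergraph \<Rightarrow> 'a \<Rightarrow> 'a \<Rightarrow> 'a \<Rightarrow> 'a list set" where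
  "OK5_triple H x1 x2 x3 = {vs \<in> ordered_5cliques H. subseq [x1, x2, x3] vs}"

definition OK5_edge :: "'a hypergraph \<Rightarrow> 'a set \<Rightarrow> 'a list set" where
  "OK5_edge H e = {vs \<in> ordered_5cliques H. e \<subseteq> set vs}"

definition W :: "'a hypergraph \<Rightarrow> 'a list \<Rightarrow> real" where
  "W H vs = (\<Prod>i=2..length vs. 1 / real (card (cliques_containing H (i + 1) (set (take i vs)))))"

definition psi :: "'a list \<Rightarrow> 'a set \<Rightarrow> real" where
  "psi vs e =
     (if e \<subseteq> set vs \<and> card (e \<inter> {vs ! 0, vs ! 1}) \<in> {0, 2} then 1 / 3
      else if e \<subseteq> set vs \<and> card (e \<inter> {vs ! 0, vs ! 1}) = 1 then - 1 / 6
      else 0)"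

definition w_edge :: "'a hypergraph \<Rightarrow> 'a set \<Rightarrow> real" where
  "w_edge H e = 1 / 2 * (\<Sum>vs\<in>OK5_edge H e. W H (take 4 vs) * psi vs e)"

definition w_triple :: "'a hypergraph \<Rightarrow> 'a \<Rightarrow> 'a \<Rightarrow> 'a \<Rightarrow> real" where
  "w_triple H x1 x2 x3 =
     1 / 2 * (\<Sum>vs\<in>OK5_triple H x1 x2 x3. W H (take 4 vs) * psi vs {x1, x2, x3})"

definition cubic :: "real \<Rightarrow> real" where
  "cubic x = 8 * x ^ 3 - 22 * x ^ 2 + 10 * x - 1"

definition xstar :: real where
  "xstar = (THE x. x \<in> {0..1/6} \<and> cubic x = 0)"

lemma cubic_strict_mono:
  assumes "0 \<le> x" "x < y" "y \<le> 1/6"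
  shows "cubic x < cubic y"
proof -
  have sq: "0 \<le> y\<^sup>2 + x * y + x\<^sup>2"
    using assms by (intro add_nonneg_nonneg mult_nonneg_nonneg) auto
  have "cubic y - cubic x = (y - x) * (8 * (y\<^sup>2 + x * y + x\<^sup>2) - 22 * (x + y) + 10)"
    unfolding cubic_def by (simp add: algebra_simps power2_eq_square power3_eq_cube)
  moreover have "8 * (y\<^sup>2 + x * y + x\<^sup>2) - 22 * (x + y) + 10 > 0"
  proof -
    have "22 * (x + y) < 10"
      using assms by simp
    moreover have "0 \<le> 8 * (y\<^sup>2 + x * y + x\<^sup>2)"
      using sq by simp
    ultimately show ?thesis
      by linarith
  qed
  ultimately show ?thesis
    using assms by (metis diff_gt_0_iff_gt mult_pos_pos)
qed

lemma cubic_ex1_root: "\<exists>!x. x \<in> {0..1/6} \<and> cubic x = 0"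
proof (rule ex_ex1I)
  have "\<exists>x\<ge>0. x \<le> 1/6 \<and> cubic x = 0"
    by (rule IVT') (auto simp: cubic_def power2_eq_square power3_eq_cube intro!: continuous_intros)
  then show "\<exists>x. x \<in> {0..1/6} \<and> cubic x = 0"
    by auto
next
  fix x y
  assume "x \<in> {0..1/6} \<and> cubic x = 0" "y \<in> {0..1/6} \<and> cubic y = 0"
  then show "x = y"
    using cubic_strict_mono[of x y] cubic_strict_mono[of y x] by (cases x y rule: linorder_cases) auto
qed

lemma xstar_root: "xstar \<in> {0..1/6}" "cubic xstar = 0"
  using theI'[OF cubic_ex1_root] unfolding xstar_def by auto

end

theory Submission
  imports Defs
begin

text \<open>
  Write \<open>d\<close>, \<open>k\<^sub>4\<close>, \<open>k\<^sub>5\<close> for the number of extensions of a pair, triple, quadruple to a clique with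
  one more vertex. Sorting the ordered 5-cliques through \<open>O = (x, y, z)\<close> by the positions of \<open>x, y, z\<close>
  and summing out the free vertices, \<open>6 w\<^sub>H(O)\<close> becomes \<open>1/d(xy)\<close> plus sums over the completions
  \<open>{x, y, z, a, b}\<close> of terms of the form \<open>(1/d(xy) - 1/d(xa))/k\<close> or \<open>(1/d(ab) - 1/d(xa))/k\<close>.
  Replacing \<open>d(xa)\<close> by its minimum \<open>(1 - x\<^sup>*) n\<close> only lowers these terms, and makes all differences
  nonpositive. The term with \<open>d(ab)\<close> is largest in modulus when \<open>d(ab) = n\<close>, which
  in turn improves the bound on \<open>k\<^sub>5(xyab)\<close>; this trade-off, and the remaining budget inequality,
  both reduce to \<open>p(x\<^sup>*) \<le> 0\<close>.

  The weighted codegree of a pair is \<open>1\<close> because every \<open>\<psi>\<^sub>K\<close> has weighted codegree \<open>1\<close> at \<open>{v\<^sub>1, v\<^sub>2}\<close>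
  and \<open>0\<close> at all other pairs, while the weights \<open>W\<close> of the ordered 5-cliques starting with a given
  ordered pair form a probability distribution (choose \<open>v\<^sub>3\<close>, \<open>v\<^sub>4\<close>, \<open>v\<^sub>5\<close> uniformly one after the other).
\<close>

section \<open>Numerical inequalities\<close>

text \<open>The two fractions are the relative losses allowed by \<open>vertex_bound\<close> and
  \<open>pair_bound\<close>. Clearing denominators leaves exactly \<open>- cubic x\<close>.\<close>

lemma cubic_budget:
  fixes x :: real
  assumes "0 \<le> x" "x < 1/6" "cubic x \<le> 0"
  shows "x / ((1-x)*(1-2*x)) + 2*x / ((1-x)*(1-4*x)) \<le> 1"
proof -
  have p: "0 < 1-x" "0 < 1-2*x" "0 < 1-4*x" using assms by auto
  have "x / ((1-x)*(1-2*x)) + 2*x / ((1-x)*(1-4*x))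
      = (x*(1-4*x) + 2*x*(1-2*x)) / ((1-x)*(1-2*x)*(1-4*x))"
    using p by (simp add: divide_simps)
  also have "\<dots> \<le> 1"
  proof -
    have "(1-x)*(1-2*x)*(1-4*x) - (x*(1-4*x) + 2*x*(1-2*x)) = - cubic x"
      by (simp add: cubic_def algebra_simps power2_eq_square power3_eq_cube)
    then show ?thesis using p assms(3) by (simp add: divide_le_eq_1)
  qed
  finally show ?thesis .
qed

text \<open>To first order in \<open>t\<close> at \<open>s = 0\<close> this is exactly \<open>cubic x \<le> 0\<close>.\<close>
lemma defect_polynomial_bound:
  fixes x s t :: real
  assumes "0 \<le> x" "x < 1/6" "cubic x \<le> 0" "0 \<le> s" "s \<le> x" "0 \<le> t" "t \<le> x"
  shows "(x-t)*((1-s)*(1-s-2*x))*(1-4*x) \<le> ((1-t)*(1-t-2*x)) * ((x+s)*(1-4*x) - 2*x*(s+t))"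
proof -
  \<comment> \<open>At \<open>s = 0\<close> the right side minus the left side vanishes at
    \<open>t = 0\<close>. \<open>G\<close> is the quotient by \<open>t\<close>, and its value at
    \<open>t = 0\<close> is \<open>- cubic x\<close>.\<close>
  define G where "G = (1-6*x)*((1-t)*(1-t-2*x)) - (1-4*x)*((x-t)*(2-2*x-t))"
  have "G = - cubic x + t*x*(2*(2-2*x) + (1-4*x) - 2*t)"
    by (simp add: G_def cubic_def algebra_simps power2_eq_square power3_eq_cube)
  moreover have "0 \<le> t*x*(2*(2-2*x) + (1-4*x) - 2*t)" using assms by simp
  ultimately have G: "0 \<le> G" using assms(3) by linarith
  \<comment> \<open>Reduction to \<open>s = 0\<close>: the left side is largest there, and the right
    side is smallest because \<open>1 - 6*x\<close> is positive.\<close>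
  have "(1-s)*(1-s-2*x) \<le> 1*(1-2*x)" using assms by (intro mult_mono) auto
  then have "(x-t)*((1-s)*(1-s-2*x))*(1-4*x) \<le> (x-t)*(1-2*x)*(1-4*x)"
    using assms by (intro mult_right_mono mult_left_mono) auto
  also have "\<dots> = ((1-t)*(1-t-2*x)) * (x*(1-4*x) - 2*x*t) - t*G"
    by (simp add: G_def algebra_simps power2_eq_square)
  also have "\<dots> \<le> ((1-t)*(1-t-2*x)) * (x*(1-4*x) - 2*x*t)"
    using G assms by simp
  also have "\<dots> \<le> ((1-t)*(1-t-2*x)) * ((x+s)*(1-4*x) - 2*x*(s+t))"
  proof (intro mult_left_mono)
    have "0 \<le> s*(1-6*x)" using assms by simp
    then show "x*(1-4*x) - 2*x*t \<le> (x+s)*(1-4*x) - 2*x*(s+t)"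
      by (simp add: algebra_simps)
  qed (use assms in auto)
  finally show ?thesis .
qed

text \<open>Here \<open>d, v, K, M, F\<close> are \<open>d(xy), d(ab), k\<^sub>4(xya), k\<^sub>4(xab), k\<^sub>5(xyab)\<close>, all divided by \<open>n\<close>.\<close>
lemma normalized_pair_bound:
  fixes x d v K M F :: real
  assumes x: "0 \<le> x" "x < 1/6" "cubic x \<le> 0"
    and d: "1-x \<le> d" "d \<le> 1" and v: "1-x \<le> v" "v \<le> 1"
    and K: "d-2*x \<le> K" and M: "v-2*x \<le> M" and F: "K+v-1-2*x \<le> F"
  shows "(1/(1-x) - 1/d)/(K*F) + (1/(1-x) - 1/v)/(M*F) \<le> 2*x / ((1-x)*(1-4*x)) / (d*K)"
proof -
  \<comment> \<open>The lower bound for \<open>F\<close> when \<open>K\<close> takes its own least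
    value \<open>d - 2*x\<close>.\<close>
  define F0 where "F0 = d+v-1-4*x"
  have pos: "0 < 1-x" "0 < 1-4*x" "0 < d" "0 < v" "0 < d-2*x" "0 < v-2*x" "0 < F0" "F0 \<le> F"
    using assms by (auto simp: F0_def)
  then have pos': "0 < K" "0 < M" "0 < F" using K M by linarith+
  have c: "1/(1-x) - 1/d = (d-1+x)/((1-x)*d)" "1/(1-x) - 1/v = (v-1+x)/((1-x)*v)"
    using pos by (simp_all add: field_simps)
  \<comment> \<open>\<open>F\<close> is at least \<open>K\<close> minus the nonnegative constant
    \<open>1 + 2*x - v\<close>, so \<open>K/F\<close> is largest when \<open>K\<close> is
    least.\<close>
  have KF: "K/F \<le> (d-2*x)/F0"
  proof -
    have "0 \<le> (1+2*x-v)*(K-(d-2*x))" using x v K by simp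
    also have "\<dots> = (d-2*x)*(K+v-1-2*x) - K*F0"
      by (simp add: F0_def algebra_simps)
    also have "\<dots> \<le> (d-2*x)*F - K*F0" using F pos by (simp add: mult_left_mono)
    finally show ?thesis using pos pos' by (simp add: divide_simps mult.commute)
  qed
  have "(1/(1-x) - 1/d)/(K*F) + (1/(1-x) - 1/v)/(M*F)
      = ((d-1+x)/F + d*(v-1+x)/v * (1/M * (K/F))) / ((1-x)*(d*K))"
    unfolding c using pos pos' by (simp add: divide_simps)
  also have "\<dots> \<le> ((d-1+x)/F0 + d*(v-1+x)/v * (1/(v-2*x) * ((d-2*x)/F0))) / ((1-x)*(d*K))"
    using pos pos' d v KF M
    by (intro divide_right_mono add_mono divide_left_mono mult_left_mono mult_mono) auto
  also have "\<dots> \<le> (2*x/(1-4*x)) / ((1-x)*(d*K))"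
  proof (intro divide_right_mono)
    \<comment> \<open>The parameters \<open>s = 1 - d\<close> and \<open>t = 1 - v\<close> are the
      relative defects of the two codegrees.\<close>
    have "(v-1+x)*(d*(d-2*x))*(1-4*x) \<le> (v*(v-2*x)) * ((x+(1-d))*(1-4*x) - 2*x*((1-d)+(1-v)))"
      using defect_polynomial_bound[of x "1-d" "1-v"] assms by (simp add: algebra_simps)
    then have "(v-1+x)*(d*(d-2*x)) / (v*(v-2*x)) \<le> ((x+(1-d))*(1-4*x) - 2*x*((1-d)+(1-v))) / (1-4*x)"
      using pos by (simp add: divide_simps mult.commute)
    also have "\<dots> = 2*x/(1-4*x)*F0 - (d-1+x)"
      using pos by (simp add: F0_def divide_simps) (simp add: algebra_simps)
    finally have "((d-1+x) + (v-1+x)*(d*(d-2*x)) / (v*(v-2*x))) / F0 \<le> 2*x/(1-4*x)"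
      using pos by (simp only: pos_divide_le_eq)
    then show "(d-1+x)/F0 + d*(v-1+x)/v * (1/(v-2*x) * ((d-2*x)/F0)) \<le> 2*x/(1-4*x)"
      by (simp add: add_divide_distrib mult_ac)
  qed (use pos pos' in auto)
  finally show ?thesis by (simp add: mult_ac)
qed

text \<open>Both sides are homogeneous of degree -3 in all quantities except \<open>x\<close>, so
  dividing these by \<open>n\<close> reduces to \<open>normalized_pair_bound\<close>.\<close>

lemma pair_bound:
  fixes x n d v K M F :: real
  assumes x: "0 \<le> x" "x < 1/6" "cubic x \<le> 0" and n: "0 < n"
    and d: "(1-x)*n \<le> d" "d \<le> n" and v: "(1-x)*n \<le> v" "v \<le> n"
    and K: "d-2*x*n \<le> K" and M: "v-2*x*n \<le> M" and F: "K+v-n-2*x*n \<le> F"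
  shows "(1/((1-x)*n) - 1/d)/(K*F) + (1/((1-x)*n) - 1/v)/(M*F)
         \<le> 2*x / ((1-x)*(1-4*x)) / (n*d*K)"
proof -
  have "(1/(1-x) - 1/(d/n))/(K/n*(F/n)) + (1/(1-x) - 1/(v/n))/(M/n*(F/n))
      \<le> 2*x / ((1-x)*(1-4*x)) / (d/n*(K/n))"
  proof (rule normalized_pair_bound)
    show "d/n - 2*x \<le> K/n" "v/n - 2*x \<le> M/n" "K/n + v/n - 1 - 2*x \<le> F/n"
      using divide_right_mono[OF K, of n] divide_right_mono[OF M, of n] divide_right_mono[OF F, of n] n
      by (simp_all add: diff_divide_distrib add_divide_distrib)
  qed (use x n d v in \<open>auto simp: field_simps\<close>)
  then have "((1/(1-x) - 1/(d/n))/(K/n*(F/n)) + (1/(1-x) - 1/(v/n))/(M/n*(F/n))) / n^3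
      \<le> (2*x / ((1-x)*(1-4*x)) / (d/n*(K/n))) / n^3"
    using n by (intro divide_right_mono) auto
  moreover have "((1/(1-x) - 1/(d/n))/(K/n*(F/n)) + (1/(1-x) - 1/(v/n))/(M/n*(F/n))) / n^3
     = (1/((1-x)*n) - 1/d)/(K*F) + (1/((1-x)*n) - 1/v)/(M*F)"
  proof -
    have "(1/(1-x) - 1/(z/n))/(L/n*(F/n)) / n^3 = (1/((1-x)*n) - 1/z)/(L*F)" for z L
    proof -
      have "(1/(1-x) - 1/(z/n)) = n * (1/((1-x)*n) - 1/z)" using n by (simp add: right_diff_distrib)
      then show ?thesis using n by (simp add: power3_eq_cube)
    qed
    then show ?thesis by (simp add: add_divide_distrib)
  qed
  moreover have "(2*x / ((1-x)*(1-4*x)) / (d/n*(K/n))) / n^3 = 2*x / ((1-x)*(1-4*x)) / (n*d*K)"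
    using n by (simp add: power3_eq_cube)
  ultimately show ?thesis by simp
qed

text \<open>For the least admissible \<open>K\<close> the ratio of \<open>d - (1-x)*n\<close> to
  \<open>d - 2*x*n\<close> increases with \<open>d\<close>, so the extreme case is
  \<open>d = n\<close>. The gap between the cross products is exactly
  \<open>(1-3*x)*(n-d)\<close>.\<close>

lemma vertex_bound:
  fixes x n d K :: real
  assumes x: "0 \<le> x" "x < 1/6" and n: "0 < n"
    and d: "(1-x)*n \<le> d" "d \<le> n" and K: "d-2*x*n \<le> K"
  shows "(1/((1-x)*n) - 1/d)/K \<le> x / ((1-x)*(1-2*x)) / (n*d)"
proof -
  have pos: "0 < 1-x" "0 < 1-2*x" "0 < (1-x)*n" using x n by auto
  have dn: "0 < d" using d pos by linarith
  have "0 < (1-3*x)*n" using x n by simp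
  then have dp: "0 < d-2*x*n" using d by (simp add: algebra_simps)
  have "(1/((1-x)*n) - 1/d)/K \<le> (1/((1-x)*n) - 1/d)/(d-2*x*n)"
    using pos dn dp d K by (intro divide_left_mono) (auto simp: frac_le)
  also have "\<dots> = (d-(1-x)*n)/(d-2*x*n) / ((1-x)*(n*d))"
    using pos dn n by (simp add: field_simps)
  also have "\<dots> \<le> (x/(1-2*x)) / ((1-x)*(n*d))"
  proof (intro divide_right_mono)
    have "0 \<le> (1-3*x)*(n-d)" using x d by simp
    then have "(d-(1-x)*n)*(1-2*x) \<le> x*(d-2*x*n)" by (simp add: algebra_simps power2_eq_square)
    then show "(d-(1-x)*n)/(d-2*x*n) \<le> x/(1-2*x)" using dp pos by (simp add: divide_simps mult.commute)
  qed (use pos dn n in auto)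
  finally show ?thesis by (simp add: mult_ac)
qed

section \<open>Clique extensions\<close>

text \<open>Extending vertices are collected instead of extended cliques, so that these sets can be
  intersected with neighbourhoods.\<close>

definition ext :: "'a hypergraph \<Rightarrow> 'a set \<Rightarrow> 'a set" where
  "ext H S = {v. v \<notin> S \<and> clique H (Suc (card S)) (insert v S)}"

lemma clique_mono: "clique H r K \<Longrightarrow> T \<subseteq> K \<Longrightarrow> card T = s \<Longrightarrow> clique H s T"
  by (auto simp: clique_def)

lemma card_cliques_containing:
  assumes "finite S"
  shows "card (cliques_containing H (Suc (card S)) S) = card (ext H S)"
proof -
  have "cliques_containing H (Suc (card S)) S = (\<lambda>v. insert v S) ` ext H S"
  proof (intro equalityI subsetI)
    fix K assume "K \<in> cliques_containing H (Suc (card S)) S"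
    then have K: "clique H (Suc (card S)) K" "S \<subseteq> K" by (auto simp: cliques_containing_def)
    then have "card K = Suc (card S)" by (simp add: clique_def)
    then have "card (K - S) = 1" using K(2) assms by (simp add: card_Diff_subset)
    then obtain v where "K - S = {v}" by (auto simp: card_1_singleton_iff)
    then have "K = insert v S" "v \<notin> S" using K(2) by auto
    then show "K \<in> (\<lambda>v. insert v S) ` ext H S" using K(1) by (auto simp: ext_def)
  qed (auto simp: ext_def cliques_containing_def)
  moreover have "inj_on (\<lambda>v. insert v S) (ext H S)"
    by (auto simp: inj_on_def ext_def)
  ultimately show ?thesis by (simp add: card_image)
qed

lemma W_four:
  assumes "distinct [a, b, c, d]"
  shows "W H [a, b, c, d] = 1 / (real (card (ext H {a, b})) * real (card (ext H {a, b, c}))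
    * real (card (ext H {a, b, c, d})))"
proof -
  have i: "{2..length [a, b, c, d]} = {2, 3, 4}" by auto
  have "card (cliques_containing H 3 {a, b}) = card (ext H {a, b})"
    "card (cliques_containing H 4 {a, b, c}) = card (ext H {a, b, c})"
    "card (cliques_containing H 5 {a, b, c, d}) = card (ext H {a, b, c, d})"
    using assms card_cliques_containing[of "{a, b}" H] card_cliques_containing[of "{a, b, c}" H]
      card_cliques_containing[of "{a, b, c, d}" H] by (auto simp: eval_nat_numeral)
  then show ?thesis unfolding W_def i by (simp add: eval_nat_numeral)
qed

text \<open>Union bound: intersecting with \<open>B y\<close> removes at most the
  \<open>card V - card (B y)\<close> elements outside it.\<close>

lemma card_Int_INT_ge:
  fixes B :: "'b \<Rightarrow> 'a set"
  assumes "finite V" "A \<subseteq> V" "finite T" "\<And>y. y \<in> T \<Longrightarrow> B y \<subseteq> V"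
  shows "real (card A) - (\<Sum>y\<in>T. real (card V) - real (card (B y))) \<le> real (card (A \<inter> (\<Inter>y\<in>T. B y)))"
  using assms(3,4)
proof (induction T rule: finite_induct)
  case (insert z T)
  let ?C = "A \<inter> (\<Inter>y\<in>T. B y)"
  have fin: "finite ?C" "finite (B z)" using assms(1,2) insert.prems by (meson finite_Int finite_subset insertI1)+
  have "card ?C + card (B z) = card (?C \<union> B z) + card (?C \<inter> B z)"
    using fin by (rule card_Un_Int)
  moreover have "card (?C \<union> B z) \<le> card V"
    using assms(1,2) insert.prems by (intro card_mono) auto
  moreover have "?C \<inter> B z = A \<inter> (\<Inter>y\<in>insert z T. B y)" by auto
  ultimately show ?case using insert by (auto simp: algebra_simps)
qed simp

section \<open>Extension sets as intersections of neighbourhoods\<close>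

locale uniform_hypergraph =
  fixes H :: "'a hypergraph"
  assumes uniform: "three_uniform H"
begin

lemma finite_vertices: "finite (vertices H)"
  using uniform by (simp add: three_uniform_def)

lemma ext_subset_vertices: "ext H S \<subseteq> vertices H"
  by (auto simp: ext_def clique_def)

lemma finite_ext: "finite (ext H S)"
  using ext_subset_vertices finite_vertices by (rule finite_subset)

lemma clique_edge: "e \<in> edges H \<Longrightarrow> clique H 3 e"
  using uniform finite_vertices
  by (auto simp: three_uniform_def clique_def) (metis card_subset_eq finite_subset)

lemma nbhd_neq: "v \<in> nbhd H {a, b} \<Longrightarrow> v \<noteq> a \<and> v \<noteq> b \<and> a \<noteq> b"
proof -
  assume "v \<in> nbhd H {a, b}"
  then have "card {v, a, b} = 3" using uniform by (auto simp: nbhd_def three_uniform_def)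
  then show ?thesis by (auto simp: card_insert_if split: if_splits)
qed

lemma nbhd_subset_vertices: "nbhd H p \<subseteq> vertices H"
  using uniform by (auto simp: nbhd_def three_uniform_def)

lemma ext_pair: "a \<noteq> b \<Longrightarrow> ext H {a, b} = nbhd H {a, b}"
proof (intro equalityI subsetI)
  fix v assume "a \<noteq> b" "v \<in> ext H {a, b}"
  then show "v \<in> nbhd H {a, b}" 
    by (auto simp: ext_def nbhd_def clique_def insert_commute)
next
  fix v assume v: "a \<noteq> b" "v \<in> nbhd H {a, b}"
  then have "clique H 3 {v, a, b}" by (auto simp: nbhd_def insert_commute intro: clique_edge)
  then show "v \<in> ext H {a, b}" using nbhd_neq[OF v(2)] v(1)
    by (auto simp: ext_def eval_nat_numeral)
qed

text \<open>A triple in the enlarged set avoids \<open>c\<close>, or avoids \<open>v\<close>, or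
  contains both. The first kind is governed by \<open>ext H S\<close>, the second by the given
  clique, the third by the neighbourhoods of the pairs \<open>{c, y}\<close>.\<close>

lemma ext_insert:
  assumes cl: "clique H (Suc (card S)) (insert c S)" and c: "c \<notin> S" and S: "finite S" "S \<noteq> {}"
  shows "ext H (insert c S) = ext H S \<inter> (\<Inter>y\<in>S. nbhd H {c, y})"
proof (intro equalityI subsetI)
  fix v assume v: "v \<in> ext H (insert c S)"
  then have vc: "v \<notin> S" "v \<noteq> c" "clique H (Suc (Suc (card S))) (insert v (insert c S))"
    using c S by (auto simp: ext_def)
  have "v \<in> nbhd H {c, y}" if "y \<in> S" for y
  proof -
    have "{c, y, v} \<subseteq> insert v (insert c S)" "card {c, y, v} = 3" using that vc c by (auto simp: card_insert_if)
    then show ?thesis using vc(3) by (simp add: clique_def nbhd_def insert_commute)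
  qed
  moreover have "v \<in> ext H S"
    using vc S clique_mono[OF vc(3), of "insert v S"] by (auto simp: ext_def)
  ultimately show "v \<in> ext H S \<inter> (\<Inter>y\<in>S. nbhd H {c, y})" by blast
next
  fix v assume v: "v \<in> ext H S \<inter> (\<Inter>y\<in>S. nbhd H {c, y})"
  then have vS: "v \<notin> S" "clique H (Suc (card S)) (insert v S)" by (auto simp: ext_def)
  \<comment> \<open>A pair \<open>{c, y}\<close> is needed to see that its neighbour
    \<open>v\<close> differs from \<open>c\<close>.\<close>
  obtain y where "y \<in> S" using S by auto
  then have vc: "v \<noteq> c" using v nbhd_neq by blast
  have "e \<in> edges H" if e: "e \<subseteq> insert v (insert c S)" "card e = 3" for e
  proof (cases "v \<in> e \<and> c \<in> e")
    case True
    then have "card (e - {v, c}) = 1" using vc e by (simp add: card_Diff_subset)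
    then obtain y where "e - {v, c} = {y}" by (auto simp: card_1_singleton_iff)
    then have "e = {c, y, v}" "y \<in> S" using True e by auto
    then show ?thesis using v by (auto simp: nbhd_def insert_commute)
  next
    case False
    then have "e \<subseteq> insert v S \<or> e \<subseteq> insert c S" using e by auto
    then show ?thesis using vS(2) cl e(2) by (auto simp: clique_def)
  qed
  then show "v \<in> ext H (insert c S)"
    using vS vc c S cl by (auto simp: ext_def clique_def)
qed

lemma card_ext_insert_ge:
  assumes "clique H (Suc (card S)) (insert c S)" "c \<notin> S" "finite S" "S \<noteq> {}"
  shows "real (card (ext H S)) - (\<Sum>y\<in>S. real (card (vertices H)) - real (card (nbhd H {c, y})))
    \<le> real (card (ext H (insert c S)))"
  unfolding ext_insert[OF assms]
  by (intro card_Int_INT_ge finite_vertices ext_subset_vertices nbhd_subset_vertices assms(3))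

lemma ext_insert_subset:
  assumes "v \<in> ext H (insert c S)" "c \<notin> S" "finite S"
  shows "v \<in> ext H S"
  using assms by (auto simp: ext_def intro: clique_mono)

lemma finite_ordered_5cliques: "finite (ordered_5cliques H)"
proof (rule finite_subset)
  show "ordered_5cliques H \<subseteq> {vs. set vs \<subseteq> vertices H \<and> length vs = 5}"
    by (auto simp: ordered_5cliques_def clique_def)
qed (use finite_lists_length_eq finite_vertices in blast)

section \<open>Expanding the weight of an ordered triple\<close>

text \<open>The pairs are ordered, to match the order in which the two further vertices occur in an
  ordered clique.\<close>

definition completions :: "'a \<Rightarrow> 'a \<Rightarrow> 'a \<Rightarrow> ('a \<times> 'a) set" where
  "completions x y z = {(a, b). distinct [x, y, z, a, b] \<and> clique H 5 {x, y, z, a, b}}"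

text \<open>Choosing \<open>a\<close> first and then \<open>b\<close> turns sums over completions
  into nested sums, in which terms free of \<open>b\<close> only pick up a factor.\<close>

lemma completions_eq_Sigma:
  assumes "distinct [x, y, z]"
  shows "completions x y z = (SIGMA a:ext H {x, y, z}. ext H {x, y, z, a})"
proof (intro equalityI subsetI)
  fix q assume "q \<in> completions x y z"
  then obtain a b where q: "q = (a, b)" "distinct [x, y, z, a, b]" "clique H 5 {x, y, z, a, b}"
    by (auto simp: completions_def)
  have "clique H 4 {x, y, z, a}" using q(2) by (intro clique_mono[OF q(3)]) auto
  then have "clique H 4 (insert a {x, y, z})" "clique H 5 (insert b {x, y, z, a})"
    using q(3) by (simp_all add: insert_commute)
  then show "q \<in> (SIGMA a:ext H {x, y, z}. ext H {x, y, z, a})"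
    using q(1,2) by (auto simp: ext_def eval_nat_numeral)
next
  fix q assume "q \<in> (SIGMA a:ext H {x, y, z}. ext H {x, y, z, a})"
  then obtain a b where q: "q = (a, b)" "a \<in> ext H {x, y, z}" "b \<in> ext H {x, y, z, a}" by auto
  then have ab: "a \<notin> {x, y, z}" "b \<notin> {x, y, z, a}" by (auto simp: ext_def)
  then have "clique H 5 (insert b {x, y, z, a})"
    using q(3) assms by (auto simp: ext_def eval_nat_numeral)
  then have "clique H 5 {x, y, z, a, b}" by (simp add: insert_commute)
  then show "q \<in> completions x y z" using assms q(1) ab by (auto simp: completions_def)
qed

text \<open>The ten summands are the ways to choose three of five positions for
  \<open>x, y, z\<close>. In the first four the triple meets the first two positions in 2 or 0
  vertices (value 1/3 of \<open>psi\<close>), in the other six in one vertex (value -1/6).\<close>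

lemma sum_OK5_triple:
  fixes h :: "'a list \<Rightarrow> real"
  assumes xyz: "distinct [x, y, z]"
  shows "(\<Sum>vs\<in>OK5_triple H x y z. h vs) = (\<Sum>(a, b)\<in>completions x y z.
     h [x, y, z, a, b] + h [x, y, a, z, b] + h [x, y, a, b, z] + h [a, b, x, y, z]
   + h [x, a, y, z, b] + h [x, a, y, b, z] + h [x, a, b, y, z]
   + h [a, x, y, z, b] + h [a, x, y, b, z] + h [a, x, b, y, z])"
proof -
  let ?P = "completions x y z"
  define f :: "nat \<Rightarrow> 'a \<times> 'a \<Rightarrow> 'a list" where "f = (\<lambda>i (a, b).
    [[x, y, z, a, b], [x, y, a, z, b], [x, y, a, b, z], [a, b, x, y, z],
     [x, a, y, z, b], [x, a, y, b, z], [x, a, b, y, z],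
     [a, x, y, z, b], [a, x, y, b, z], [a, x, b, y, z]] ! i)"
  have I: "{..<10} = {0, 1, 2, 3, 4, 5, 6, 7, 8, 9::nat}" by auto
  have fsimps: "f 0 (a, b) = [x, y, z, a, b]" "f (Suc 0) (a, b) = [x, y, a, z, b]"
    "f 2 (a, b) = [x, y, a, b, z]" "f 3 (a, b) = [a, b, x, y, z]"
    "f 4 (a, b) = [x, a, y, z, b]" "f 5 (a, b) = [x, a, y, b, z]" "f 6 (a, b) = [x, a, b, y, z]"
    "f 7 (a, b) = [a, x, y, z, b]" "f 8 (a, b) = [a, x, y, b, z]" "f 9 (a, b) = [a, x, b, y, z]" for a b
    by (simp_all add: f_def)
  have P: "a \<noteq> b \<and> a \<noteq> x \<and> a \<noteq> y \<and> a \<noteq> z \<and> b \<noteq> x \<and> b \<noteq> y \<and> b \<noteq> z" if "(a, b) \<in> ?P" for a b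
    using that by (auto simp: completions_def)
  have cases10: "i \<in> {0, 1, 2, 3, 4, 5, 6, 7, 8, 9}" if "i < 10" for i :: nat
    using that by auto
  \<comment> \<open>The pattern of positions held by \<open>x, y, z\<close> determines
    \<open>i\<close>, and the remaining entries determine \<open>(a, b)\<close>; this gives
    injectivity.\<close>
  define pats where "pats =
    [[True, True, True, False, False], [True, True, False, True, False], [True, True, False, False, True],
     [False, False, True, True, True], [True, False, True, True, False], [True, False, True, False, True],
     [True, False, False, True, True], [False, True, True, True, False], [False, True, True, False, True],
     [False, True, False, True, True]]"
  have pat: "map (\<lambda>v. v \<in> {x, y, z}) (f i (a, b)) = pats ! i" if "i < 10" "(a, b) \<in> ?P" for i a b
    using cases10[OF that(1)] P[OF that(2)] by (elim insertE emptyE) (simp_all add: f_def pats_def)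
  have rest: "filter (\<lambda>v. v \<notin> {x, y, z}) (f i (a, b)) = [a, b]" if "i < 10" "(a, b) \<in> ?P" for i a b
    using cases10[OF that(1)] P[OF that(2)] by (elim insertE emptyE) (simp_all add: f_def)
  have inj: "inj_on (\<lambda>(i, q). f i q) ({..<10} \<times> ?P)"
  proof (rule inj_onI)
    fix s t assume st: "s \<in> {..<10} \<times> ?P" "t \<in> {..<10} \<times> ?P" "(\<lambda>(i, q). f i q) s = (\<lambda>(i, q). f i q) t"
    obtain i a b j c d where st': "s = (i, a, b)" "t = (j, c, d)" by (metis surj_pair)
    with st have *: "i < 10" "j < 10" "(a, b) \<in> ?P" "(c, d) \<in> ?P"
      and eq: "f i (a, b) = f j (c, d)" by auto
    have "map (\<lambda>v. v \<in> {x, y, z}) (f i (a, b)) = map (\<lambda>v. v \<in> {x, y, z}) (f j (c, d))"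
      using eq by simp
    then have "pats ! i = pats ! j" using pat[OF *(1,3)] pat[OF *(2,4)] by simp
    moreover have "distinct pats" "length pats = 10" by (simp_all add: pats_def)
    ultimately have "i = j" using *(1,2) by (simp add: nth_eq_iff_index_eq)
    moreover have "filter (\<lambda>v. v \<notin> {x, y, z}) (f i (a, b)) = filter (\<lambda>v. v \<notin> {x, y, z}) (f j (c, d))"
      using eq by simp
    then have "[a, b] = [c, d]" using rest[OF *(1,3)] rest[OF *(2,4)] by simp
    ultimately show "s = t" using st' by simp
  qed
  have img: "(\<lambda>(i, q). f i q) ` ({..<10} \<times> ?P) = OK5_triple H x y z"
  proof (intro equalityI subsetI)
    fix vs assume "vs \<in> (\<lambda>(i, q). f i q) ` ({..<10} \<times> ?P)"
    then obtain i a b where i: "i \<in> {0, 1, 2, 3, 4, 5, 6, 7, 8, 9}" "(a, b) \<in> ?P" "vs = f i (a, b)"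
      unfolding I by auto
    then show "vs \<in> OK5_triple H x y z" using P[OF i(2)] xyz
      by (elim insertE emptyE)
        (simp_all add: fsimps OK5_triple_def ordered_5cliques_def completions_def insert_commute)
  next
    fix vs assume vs: "vs \<in> OK5_triple H x y z"
    then have "length vs = 5" by (simp add: OK5_triple_def ordered_5cliques_def)
    then obtain v1 v2 v3 v4 v5 where v: "vs = [v1, v2, v3, v4, v5]"
      by (auto simp: eval_nat_numeral length_Suc_conv)
    have d: "distinct vs" "clique H 5 (set vs)" "subseq [x, y, z] vs"
      using vs by (auto simp: OK5_triple_def ordered_5cliques_def)
    have "\<exists>i\<in>{0, 1, 2, 3, 4, 5, 6, 7, 8, 9}. \<exists>a b. vs = f i (a, b)"
      using d(3) unfolding v by (auto simp: fsimps split: if_splits)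
    then obtain i a b where i: "i \<in> {0, 1, 2, 3, 4, 5, 6, 7, 8, 9}" "vs = f i (a, b)" by blast
    have "set vs = {x, y, z, a, b}" using i by (elim insertE emptyE) (auto simp: fsimps)
    moreover have "distinct [x, y, z, a, b]"
      using i d(1) xyz by (elim insertE emptyE) (auto simp: fsimps)
    ultimately have "(a, b) \<in> ?P" using d(2) by (simp add: completions_def)
    then show "vs \<in> (\<lambda>(i, q). f i q) ` ({..<10} \<times> ?P)" using i unfolding I by auto
  qed
  have "(\<Sum>vs\<in>OK5_triple H x y z. h vs) = (\<Sum>(i, q)\<in>{..<10} \<times> ?P. h (f i q))"
    unfolding img[symmetric] by (subst sum.reindex[OF inj]) (simp add: case_prod_unfold)
  also have "\<dots> = (\<Sum>q\<in>?P. \<Sum>i<10. h (f i q))"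
    by (simp add: sum.cartesian_product[symmetric] sum.swap[of _ "{..<10}"])
  also have "\<dots> = (\<Sum>(a, b)\<in>?P.
     h [x, y, z, a, b] + h [x, y, a, z, b] + h [x, y, a, b, z] + h [a, b, x, y, z]
   + h [x, a, y, z, b] + h [x, a, y, b, z] + h [x, a, b, y, z]
   + h [a, x, y, z, b] + h [a, x, y, b, z] + h [a, x, b, y, z])"
    unfolding I by (intro sum.cong) (auto simp: fsimps)
  finally show ?thesis .
qed

text \<open>\<open>W\<close> does not change when the first two vertices are swapped, so the six
  negative placements form three equal pairs of total coefficient -1/3. Each pair shares its last
  two denominators with one of the positive placements 2 to 4.\<close>

lemma w_triple_eq:
  assumes xyz: "distinct [x, y, z]"
  defines "k \<equiv> \<lambda>S. real (card (ext H S))"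
  shows "w_triple H x y z = (\<Sum>(a, b)\<in>completions x y z.
      1 / (k {x, y} * k {x, y, z} * k {x, y, z, a})
    + (1 / k {x, y} - 1 / k {x, a}) / (k {x, y, a} * k {x, y, z, a})
    + (1 / k {x, y} - 1 / k {x, a}) / (k {x, y, a} * k {x, y, a, b})
    + (1 / k {a, b} - 1 / k {x, a}) / (k {x, a, b} * k {x, y, a, b})) / 6"
  unfolding w_triple_def sum_OK5_triple[OF xyz] sum_distrib_left sum_divide_distrib
proof (intro sum.cong refl, clarify)
  fix a b assume "(a, b) \<in> completions x y z"
  then have d: "distinct [x, y, z, a, b]" by (simp add: completions_def)
  then have d': "distinct [b, a, z, y, x]" by auto
  have four: "take 4 [p, q, r, s, t] = [p, q, r, s]" for p q r s t :: 'a
    by (simp add: eval_nat_numeral)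
  have psi: "psi [x, y, z, a, b] {x, y, z} = 1/3" "psi [x, y, a, z, b] {x, y, z} = 1/3"
    "psi [x, y, a, b, z] {x, y, z} = 1/3" "psi [a, b, x, y, z] {x, y, z} = 1/3"
    "psi [x, a, y, z, b] {x, y, z} = -1/6" "psi [x, a, y, b, z] {x, y, z} = -1/6"
    "psi [x, a, b, y, z] {x, y, z} = -1/6" "psi [a, x, y, z, b] {x, y, z} = -1/6"
    "psi [a, x, y, b, z] {x, y, z} = -1/6" "psi [a, x, b, y, z] {x, y, z} = -1/6"
    using d d' by (simp_all add: psi_def Int_insert_left)
  have W: "W H [p, q, r, s] = 1 / (k {p, q} * k {p, q, r} * k {p, q, r, s})"
    if "distinct [p, q, r, s]" for p q r s
    using W_four[OF that] by (simp add: k_def)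
  have Ws: "W H [x, y, z, a] = 1 / (k {x, y} * k {x, y, z} * k {x, y, z, a})"
    "W H [x, y, a, z] = 1 / (k {x, y} * k {x, y, a} * k {x, y, z, a})"
    "W H [x, y, a, b] = 1 / (k {x, y} * k {x, y, a} * k {x, y, a, b})"
    "W H [a, b, x, y] = 1 / (k {a, b} * k {x, a, b} * k {x, y, a, b})"
    "W H [x, a, y, z] = 1 / (k {x, a} * k {x, y, a} * k {x, y, z, a})"
    "W H [x, a, y, b] = 1 / (k {x, a} * k {x, y, a} * k {x, y, a, b})"
    "W H [x, a, b, y] = 1 / (k {x, a} * k {x, a, b} * k {x, y, a, b})"
    "W H [a, x, y, z] = 1 / (k {x, a} * k {x, y, a} * k {x, y, z, a})"
    "W H [a, x, y, b] = 1 / (k {x, a} * k {x, y, a} * k {x, y, a, b})"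
    "W H [a, x, b, y] = 1 / (k {x, a} * k {x, a, b} * k {x, y, a, b})"
    using d d' by (simp_all add: W insert_commute)
  show "1 / 2 * (W H (take 4 [x, y, z, a, b]) * psi [x, y, z, a, b] {x, y, z}
      + W H (take 4 [x, y, a, z, b]) * psi [x, y, a, z, b] {x, y, z}
      + W H (take 4 [x, y, a, b, z]) * psi [x, y, a, b, z] {x, y, z}
      + W H (take 4 [a, b, x, y, z]) * psi [a, b, x, y, z] {x, y, z}
      + W H (take 4 [x, a, y, z, b]) * psi [x, a, y, z, b] {x, y, z}
      + W H (take 4 [x, a, y, b, z]) * psi [x, a, y, b, z] {x, y, z}
      + W H (take 4 [x, a, b, y, z]) * psi [x, a, b, y, z] {x, y, z}
      + W H (take 4 [a, x, y, z, b]) * psi [a, x, y, z, b] {x, y, z}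
      + W H (take 4 [a, x, y, b, z]) * psi [a, x, y, b, z] {x, y, z}
      + W H (take 4 [a, x, b, y, z]) * psi [a, x, b, y, z] {x, y, z}) =
    (1 / (k {x, y} * k {x, y, z} * k {x, y, z, a})
    + (1 / k {x, y} - 1 / k {x, a}) / (k {x, y, a} * k {x, y, z, a})
    + (1 / k {x, y} - 1 / k {x, a}) / (k {x, y, a} * k {x, y, a, b})
    + (1 / k {a, b} - 1 / k {x, a}) / (k {x, a, b} * k {x, y, a, b})) / 6"
    unfolding four psi Ws by (simp add: diff_divide_distrib add_divide_distrib mult.assoc)
qed

section \<open>Weighted codegrees\<close>

text \<open>The values 1/3, -1/6, 1/3 at overlaps 0, 1, 2 are made for this: the three edges of the
  clique through \<open>p\<close> sum to 1/3 - 2/6 when \<open>p\<close> meets the first pair in 0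
  or 1 vertices, and to 3/3 when \<open>p\<close> equals it.\<close>

lemma sum_psi_pair:
  assumes vs: "vs \<in> ordered_5cliques H" and p: "card p = 2"
  shows "(\<Sum>f\<in>{f\<in>edges H. p \<subseteq> f \<and> f \<subseteq> set vs}. psi vs f) = (if p = {vs ! 0, vs ! 1} then 1 else 0)"
proof (cases "p \<subseteq> set vs")
  case False
  have "vs ! 0 \<in> set vs" "vs ! 1 \<in> set vs" using vs by (auto simp: ordered_5cliques_def)
  then have "p \<noteq> {vs ! 0, vs ! 1}" using False by auto
  moreover have empty: "{f\<in>edges H. p \<subseteq> f \<and> f \<subseteq> set vs} = {}" using False by blast
  ultimately show ?thesis unfolding empty by simp
next
  case True
  let ?q = "{vs ! 0, vs ! 1}"
  have l: "length vs = 5" "distinct vs" "clique H 5 (set vs)" using vs by (auto simp: ordered_5cliques_def)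
  have fin: "finite p" using True by (rule finite_subset) simp
  have q: "?q \<subseteq> set vs" "card ?q = 2"
    using l by (auto simp: nth_eq_iff_index_eq)
  have "{f\<in>edges H. p \<subseteq> f \<and> f \<subseteq> set vs} = (\<lambda>w. insert w p) ` (set vs - p)"
  proof (intro equalityI subsetI)
    fix f assume "f \<in> {f\<in>edges H. p \<subseteq> f \<and> f \<subseteq> set vs}"
    then have f: "card f = 3" "p \<subseteq> f" "f \<subseteq> set vs" using uniform by (auto simp: three_uniform_def)
    then have "card (f - p) = 1" using fin p by (simp add: card_Diff_subset)
    then obtain w where "f - p = {w}" by (auto simp: card_1_singleton_iff)
    then have "f = insert w p" "w \<in> set vs - p" using f by auto
    then show "f \<in> (\<lambda>w. insert w p) ` (set vs - p)" by auto
  next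
    fix f assume "f \<in> (\<lambda>w. insert w p) ` (set vs - p)"
    then obtain w where w: "w \<in> set vs" "w \<notin> p" "f = insert w p" by auto
    then have "card f = 3" "f \<subseteq> set vs" using fin p True by auto
    then show "f \<in> {f\<in>edges H. p \<subseteq> f \<and> f \<subseteq> set vs}" using w l by (auto simp: clique_def)
  qed
  moreover have "inj_on (\<lambda>w. insert w p) (set vs - p)" by (auto simp: inj_on_def)
  ultimately have "(\<Sum>f\<in>{f\<in>edges H. p \<subseteq> f \<and> f \<subseteq> set vs}. psi vs f)
      = (\<Sum>w\<in>set vs - p. psi vs (insert w p))"
    by (simp add: sum.reindex)
  also have "set vs - p = (?q - p) \<union> (set vs - ?q - p)" using q by auto
  also have "(\<Sum>w\<in>(?q - p) \<union> (set vs - ?q - p). psi vs (insert w p))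
      = (\<Sum>w\<in>?q - p. psi vs (insert w p)) + (\<Sum>w\<in>set vs - ?q - p. psi vs (insert w p))"
    by (rule sum.union_disjoint) auto
  finally have split: "(\<Sum>f\<in>{f\<in>edges H. p \<subseteq> f \<and> f \<subseteq> set vs}. psi vs f) = \<dots>" .
  \<comment> \<open>With \<open>j\<close> the overlap of \<open>p\<close> and \<open>{v\<^sub>1, v\<^sub>2}\<close>, the sum is \<open>(2 - j) \<phi> (j + 1) + (j + 1) \<phi> j\<close>.\<close>
  define j where "j = card (p \<inter> ?q)"
  define \<phi> :: "nat \<Rightarrow> real" where "\<phi> m = (if m \<in> {0, 2} then 1/3 else if m = 1 then -1/6 else 0)" for m
  have psi: "psi vs (insert w p) = \<phi> (card (insert w p \<inter> ?q))" if "w \<in> set vs" for w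
    using that True by (simp only: psi_def \<phi>_def insert_subset simp_thms)
  have "(\<Sum>w\<in>?q - p. psi vs (insert w p)) = (\<Sum>w\<in>?q - p. \<phi> (Suc j))"
  proof (intro sum.cong refl)
    fix w assume w: "w \<in> ?q - p"
    then have "insert w p \<inter> ?q = insert w (p \<inter> ?q)" by auto
    moreover have "w \<notin> p \<inter> ?q" using w by blast
    ultimately have "card (insert w p \<inter> ?q) = Suc j" using fin by (simp only: j_def finite_Int card_insert_disjoint simp_thms)
    then show "psi vs (insert w p) = \<phi> (Suc j)" using psi[of w] w q by auto
  qed
  moreover have "(\<Sum>w\<in>set vs - ?q - p. psi vs (insert w p)) = (\<Sum>w\<in>set vs - ?q - p. \<phi> j)"
  proof (intro sum.cong refl)
    fix w assume w: "w \<in> set vs - ?q - p"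
    then have "insert w p \<inter> ?q = p \<inter> ?q" by auto
    then show "psi vs (insert w p) = \<phi> j" using psi[of w] w by (simp add: j_def)
  qed
  moreover have "card (?q - p) = 2 - j"
    using q fin unfolding j_def by (subst card_Diff_subset_Int) (auto simp: Int_commute)
  moreover have "card (set vs - ?q - p) = Suc j"
  proof -
    have "card (p \<union> ?q) + j = 4" unfolding j_def using card_Un_Int[of p ?q] fin p q by simp
    moreover have "card (set vs - (?q \<union> p)) = 5 - card (?q \<union> p)"
      using q True fin l by (subst card_Diff_subset) (auto simp: distinct_card)
    moreover have "j \<le> 2" unfolding j_def using fin p card_mono[of p "p \<inter> ?q"] by simp
    ultimately show ?thesis by (simp add: Diff_Diff_Int Un_commute set_diff_eq Collect_conj_eq) 
  qed
  moreover have j: "j \<le> 2" unfolding j_def using fin p card_mono[of p "p \<inter> ?q"] by simp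
  moreover have "j = 2 \<longleftrightarrow> p = ?q"
  proof
    assume "j = 2"
    have "p \<inter> ?q = p" using \<open>j = 2\<close> fin p by (intro card_subset_eq) (simp_all add: j_def)
    moreover have "p \<inter> ?q = ?q" using \<open>j = 2\<close> q by (intro card_subset_eq) (simp_all add: j_def)
    ultimately show "p = ?q" by metis
  qed (use p in \<open>simp add: j_def\<close>)
  moreover have "j \<in> {0, 1, 2}" using j by auto
  ultimately show ?thesis unfolding split by (auto simp: \<phi>_def)
qed

text \<open>Double counting: after swapping the sums over edges and cliques,
  \<open>sum_psi_pair\<close> removes every clique whose first two vertices are not
  \<open>p\<close>.\<close>

lemma weighted_codeg_w_edge:
  assumes p: "card p = 2"
  shows "weighted_codeg H (w_edge H) p
    = (\<Sum>vs\<in>{vs\<in>ordered_5cliques H. p = {vs ! 0, vs ! 1}}. W H (take 4 vs)) / 2"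
proof -
  let ?E = "{e\<in>edges H. p \<subseteq> e}" and ?O = "ordered_5cliques H"
  have fin: "finite ?O" by (rule finite_ordered_5cliques)
  have "finite (edges H)"
    using uniform by (intro finite_subset[of "edges H" "Pow (vertices H)"]) (auto simp: three_uniform_def)
  then have finE: "finite ?E" by simp
  have "weighted_codeg H (w_edge H) p
      = (\<Sum>e\<in>?E. \<Sum>vs\<in>?O. if e \<subseteq> set vs then W H (take 4 vs) * psi vs e / 2 else 0)"
    unfolding weighted_codeg_def w_edge_def OK5_edge_def sum_distrib_left
    by (rule sum.cong[OF refl], subst sum.inter_filter[OF fin]) (simp cong: if_cong)
  also have "\<dots> = (\<Sum>vs\<in>?O. \<Sum>e\<in>?E. if e \<subseteq> set vs then W H (take 4 vs) * psi vs e / 2 else 0)"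
    by (rule sum.swap)
  also have "\<dots> = (\<Sum>vs\<in>?O. if p = {vs ! 0, vs ! 1} then W H (take 4 vs) / 2 else 0)"
  proof (rule sum.cong[OF refl])
    fix vs assume vs: "vs \<in> ?O"
    have "(\<Sum>e\<in>?E. if e \<subseteq> set vs then W H (take 4 vs) * psi vs e / 2 else 0)
        = (\<Sum>e\<in>{e\<in>?E. e \<subseteq> set vs}. W H (take 4 vs) / 2 * psi vs e)"
      by (subst sum.inter_filter[OF finE]) (simp cong: if_cong)
    also have "\<dots> = W H (take 4 vs) / 2 * (\<Sum>e\<in>{f\<in>edges H. p \<subseteq> f \<and> f \<subseteq> set vs}. psi vs e)"
      by (simp add: sum_distrib_left conj_assoc)
    also have "\<dots> = (if p = {vs ! 0, vs ! 1} then W H (take 4 vs) / 2 else 0)"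
      unfolding sum_psi_pair[OF vs p] by simp
    finally show "(\<Sum>e\<in>?E. if e \<subseteq> set vs then W H (take 4 vs) * psi vs e / 2 else 0)
        = (if p = {vs ! 0, vs ! 1} then W H (take 4 vs) / 2 else 0)" .
  qed
  also have "\<dots> = (\<Sum>vs\<in>{vs\<in>?O. p = {vs ! 0, vs ! 1}}. W H (take 4 vs)) / 2"
    by (subst sum.inter_filter[OF fin]) (auto simp: sum_divide_distrib intro!: sum.cong)
  finally show ?thesis .
qed

text \<open>Summing out the fifth, fourth and third vertex cancels one factor of \<open>W\<close>
  each time. Nonemptiness ensures that no random choice gets stuck.\<close>

lemma sum_W_starting_with:
  assumes yz: "y \<noteq> z" and pos: "ext H {y, z} \<noteq> {}"
    "\<And>c. c \<in> ext H {y, z} \<Longrightarrow> ext H {y, z, c} \<noteq> {}"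
    "\<And>c d. c \<in> ext H {y, z} \<Longrightarrow> d \<in> ext H {y, z, c} \<Longrightarrow> ext H {y, z, c, d} \<noteq> {}"
  shows "(\<Sum>vs\<in>{vs\<in>ordered_5cliques H. vs ! 0 = y \<and> vs ! 1 = z}. W H (take 4 vs)) = 1"
proof -
  let ?S = "SIGMA c:ext H {y, z}. completions y z c"
  let ?f = "\<lambda>(c, d, e). [y, z, c, d, e]"
  define k where "k = (\<lambda>S. real (card (ext H S)))"
  note fin = finite_ext
  have k0: "k S > 0" if "ext H S \<noteq> {}" for S
    using that fin by (simp add: k_def card_gt_0_iff)
  have "{vs\<in>ordered_5cliques H. vs ! 0 = y \<and> vs ! 1 = z} = ?f ` ?S"
  proof (intro equalityI subsetI)
    fix vs assume vs: "vs \<in> {vs\<in>ordered_5cliques H. vs ! 0 = y \<and> vs ! 1 = z}"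
    then have "length vs = 5" by (simp add: ordered_5cliques_def)
    then obtain c d e where v: "vs = [y, z, c, d, e]"
      using vs by (auto simp: eval_nat_numeral length_Suc_conv)
    then have *: "distinct [y, z, c, d, e]" "clique H 5 {y, z, c, d, e}"
      using vs by (auto simp: ordered_5cliques_def)
    have "clique H 3 {c, y, z}" using *(1) by (intro clique_mono[OF *(2)]) auto
    then have "c \<in> ext H {y, z}" using *(1) by (auto simp: ext_def eval_nat_numeral)
    then have "(c, d, e) \<in> ?S" using * by (simp add: completions_def)
    then show "vs \<in> ?f ` ?S" unfolding v by force
  qed (auto simp: ordered_5cliques_def completions_def)
  moreover have "inj_on ?f ?S" by (auto simp: inj_on_def)
  ultimately have "(\<Sum>vs\<in>{vs\<in>ordered_5cliques H. vs ! 0 = y \<and> vs ! 1 = z}. W H (take 4 vs))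
      = (\<Sum>(c, d, e)\<in>?S. W H [y, z, c, d])"
    by (simp add: sum.reindex case_prod_unfold eval_nat_numeral)
  also have "\<dots> = (\<Sum>(c, d, e)\<in>?S. 1 / (k {y, z} * k {y, z, c} * k {y, z, c, d}))"
    by (intro sum.cong refl) (auto simp: W_four completions_def k_def)
  also have "\<dots> = (\<Sum>c\<in>ext H {y, z}. \<Sum>(d, e)\<in>completions y z c. 1 / (k {y, z} * k {y, z, c} * k {y, z, c, d}))"
  proof (rule sum.Sigma[symmetric, OF fin], rule ballI)
    fix c assume "c \<in> ext H {y, z}"
    then have "distinct [y, z, c]" using yz by (auto simp: ext_def)
    then show "finite (completions y z c)"
      by (simp add: completions_eq_Sigma fin)
  qed
  also have "\<dots> = (\<Sum>c\<in>ext H {y, z}. 1 / k {y, z})"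
  proof (rule sum.cong[OF refl])
    fix c assume c: "c \<in> ext H {y, z}"
    then have "distinct [y, z, c]" using yz by (auto simp: ext_def)
    then have "(\<Sum>(d, e)\<in>completions y z c. 1 / (k {y, z} * k {y, z, c} * k {y, z, c, d}))
        = (\<Sum>d\<in>ext H {y, z, c}. \<Sum>e\<in>ext H {y, z, c, d}. 1 / (k {y, z} * k {y, z, c} * k {y, z, c, d}))"
      unfolding completions_eq_Sigma[OF \<open>distinct [y, z, c]\<close>] by (intro sum.Sigma[symmetric]) (auto simp: fin)
    also have "\<dots> = (\<Sum>d\<in>ext H {y, z, c}. 1 / (k {y, z} * k {y, z, c}))"
    proof (rule sum.cong[OF refl])
      fix d assume "d \<in> ext H {y, z, c}"
      then have "k {y, z, c, d} > 0" using c k0 pos by blast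
      then show "(\<Sum>e\<in>ext H {y, z, c, d}. 1 / (k {y, z} * k {y, z, c} * k {y, z, c, d}))
          = 1 / (k {y, z} * k {y, z, c})"
        by (simp add: k_def)
    qed
    also have "\<dots> = 1 / k {y, z}" using k0[OF pos(2)[OF c]] by (simp add: k_def)
    finally show "(\<Sum>(d, e)\<in>completions y z c. 1 / (k {y, z} * k {y, z, c} * k {y, z, c, d})) = 1 / k {y, z}" .
  qed
  also have "\<dots> = 1" using k0[OF pos(1)] by (simp add: k_def)
  finally show ?thesis .
qed

text \<open>Every ordered clique containing \<open>e\<close> induces exactly one ordering of
  \<open>e\<close>, so \<open>w_edge\<close> splits into the weights of the orderings.\<close>

lemma w_edge_nonneg:
  assumes pos: "\<And>x y z. distinct [x, y, z] \<Longrightarrow> {x, y, z} = e \<Longrightarrow> w_triple H x y z \<ge> 0"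
    and e: "card e = 3"
  shows "w_edge H e \<ge> 0"
proof -
  define L where "L = {l. distinct l \<and> set l = e}"
  have fine: "finite e" using e by (simp add: card_ge_0_finite)
  have "L \<subseteq> {l. set l \<subseteq> e \<and> length l = 3}" using e by (auto simp: L_def distinct_card)
  then have finL: "finite L" using finite_lists_length_eq[OF fine] finite_subset by blast
  have finO: "finite (OK5_edge H e)"
    using finite_ordered_5cliques by (simp add: OK5_edge_def)
  have fibre: "{vs \<in> OK5_edge H e. filter (\<lambda>v. v \<in> e) vs = l} = {vs\<in>ordered_5cliques H. subseq l vs}"
    if l: "l \<in> L" for l
  proof (intro equalityI subsetI)
    fix vs assume "vs \<in> {vs \<in> OK5_edge H e. filter (\<lambda>v. v \<in> e) vs = l}"
    then show "vs \<in> {vs\<in>ordered_5cliques H. subseq l vs}" by (auto simp: OK5_edge_def)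
  next
    fix vs assume vs: "vs \<in> {vs\<in>ordered_5cliques H. subseq l vs}"
    then have d: "distinct vs" "subseq l vs" by (auto simp: ordered_5cliques_def)
    have "set l \<subseteq> set vs" using d(2) by (metis notin_set_nthsI subseq_conv_nths subsetI)
    then have sub: "e \<subseteq> set vs" using l by (simp add: L_def)
    have "filter (\<lambda>v. v \<in> e) l = l" using l by (simp add: L_def)
    \<comment> \<open>A subsequence of the same length is the whole list, so the induced ordering is
      \<open>l\<close>.\<close>
    then have "subseq l (filter (\<lambda>v. v \<in> e) vs)" using subseq_filter[OF d(2)] by metis
    moreover have "length (filter (\<lambda>v. v \<in> e) vs) = length l"
    proof -
      have "length (filter (\<lambda>v. v \<in> e) vs) = card (set vs \<inter> e)"
        using d(1) distinct_card[of "filter (\<lambda>v. v \<in> e) vs"] by (simp add: Int_def)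
      also have "\<dots> = length l" using sub l by (simp add: L_def Int_absorb1 distinct_card[symmetric])
      finally show ?thesis .
    qed
    ultimately have "filter (\<lambda>v. v \<in> e) vs = l" by (metis subseq_same_length)
    then show "vs \<in> {vs \<in> OK5_edge H e. filter (\<lambda>v. v \<in> e) vs = l}"
      using vs sub by (simp add: OK5_edge_def)
  qed
  have "w_edge H e = (\<Sum>l\<in>L. 1 / 2 * (\<Sum>vs\<in>{vs \<in> OK5_edge H e. filter (\<lambda>v. v \<in> e) vs = l}. W H (take 4 vs) * psi vs e))"
    unfolding w_edge_def sum_distrib_left[symmetric]
    by (subst sum.group[OF finO finL]) (auto simp: L_def OK5_edge_def ordered_5cliques_def)
  also have "\<dots> \<ge> 0"
  proof (rule sum_nonneg)
    fix l assume l: "l \<in> L"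
    then have "length l = 3" using e by (auto simp: L_def distinct_card)
    then obtain x y z where xyz: "l = [x, y, z]" by (auto simp: eval_nat_numeral length_Suc_conv)
    then have "distinct [x, y, z]" "{x, y, z} = e" using l by (auto simp: L_def)
    then show "0 \<le> 1 / 2 * (\<Sum>vs\<in>{vs \<in> OK5_edge H e. filter (\<lambda>v. v \<in> e) vs = l}. W H (take 4 vs) * psi vs e)"
      using pos[of x y z] unfolding fibre[OF l] by (simp add: w_triple_def OK5_triple_def xyz)
  qed
  finally show ?thesis .
qed

end

section \<open>Dense hypergraphs\<close>

text \<open>Density is stated for pairs inside edges, so it is meaningful even without edges, when
  \<open>min_ess_codeg\<close> is unspecified.\<close>

locale dense_hypergraph = uniform_hypergraph H for H :: "'a hypergraph" +
  fixes x :: real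
  assumes nonempty: "vertices H \<noteq> {}"
    and x: "0 \<le> x" "x < 1/6" "cubic x \<le> 0"
    and dense: "\<lbrakk>e \<in> edges H; a \<in> e; b \<in> e; a \<noteq> b\<rbrakk>
      \<Longrightarrow> (1 - x) * real (card (vertices H)) \<le> real (codeg H {a, b})"
begin

abbreviation k where "k S \<equiv> real (card (ext H S))"
abbreviation n where "n \<equiv> real (card (vertices H))"

section \<open>Lower bounds on extension counts\<close>

lemma n_pos: "0 < n"
  using nonempty finite_vertices by (simp add: card_gt_0_iff)

lemma k_le: "k S \<le> n"
  using ext_subset_vertices finite_vertices by (simp add: card_mono)

lemma k_pair:
  assumes "clique H r K" "3 \<le> r" "a \<in> K" "b \<in> K" "a \<noteq> b"
  shows "k {a, b} = real (card (nbhd H {a, b}))" "(1 - x) * n \<le> k {a, b}"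
proof -
  show eq: "k {a, b} = real (card (nbhd H {a, b}))" using ext_pair[OF assms(5)] by simp
  have "finite K" using assms(1,2) by (intro card_ge_0_finite) (auto simp: clique_def)
  then have "card (K - {a, b}) > 0" using assms by (subst card_Diff_subset) (auto simp: clique_def)
  then obtain c where "c \<in> K - {a, b}" by (metis card_gt_0_iff ex_in_conv)
  then have "{a, b, c} \<subseteq> K" "card {a, b, c} = 3" using assms by (auto simp: card_insert_if)
  then have "{a, b, c} \<in> edges H" using assms(1) by (auto simp: clique_def)
  from dense[OF this, of a b] assms(5) show "(1 - x) * n \<le> k {a, b}"
    by (simp add: eq codeg_def)
qed

text \<open>Adding \<open>c\<close> creates two new pairs, each losing at most \<open>x * n\<close>
  vertices.\<close>

lemma k_triple_ge:
  assumes "clique H 3 {a, b, c}" "distinct [a, b, c]"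
  shows "k {a, b} - 2 * x * n \<le> k {a, b, c}"
proof -
  have s: "insert c {a, b} = {a, b, c}" by auto
  have "k {a, b} - (\<Sum>y\<in>{a, b}. n - real (card (nbhd H {c, y}))) \<le> k (insert c {a, b})"
    using assms by (intro card_ext_insert_ge) (auto simp: s eval_nat_numeral)
  moreover have "(1 - x) * n \<le> real (card (nbhd H {c, y}))" if "y \<in> {a, b}" for y
    using k_pair[OF assms(1), of c y] that assms(2) by auto
  from this[of a] this[of b]
  have "(\<Sum>y\<in>{a, b}. n - real (card (nbhd H {c, y}))) \<le> 2 * x * n"
    using assms(2) by (simp add: algebra_simps)
  ultimately show ?thesis unfolding s by simp
qed

text \<open>Only two of the three new pairs are estimated by the minimum; \<open>{c, d}\<close>
  keeps its true codegree, which the trade-off in \<open>pair_bound\<close> relies on.\<close>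

lemma k_four_ge:
  assumes "clique H 4 {a, b, c, d}" "distinct [a, b, c, d]"
  shows "k {a, b, c} + k {c, d} - n - 2 * x * n \<le> k {a, b, c, d}"
proof -
  have s: "insert d {a, b, c} = {a, b, c, d}" by auto
  have "k {a, b, c} - (\<Sum>y\<in>{a, b, c}. n - real (card (nbhd H {d, y}))) \<le> k (insert d {a, b, c})"
    using assms by (intro card_ext_insert_ge) (auto simp: s eval_nat_numeral)
  moreover have "(1 - x) * n \<le> real (card (nbhd H {d, y}))" if "y \<in> {a, b}" for y
    using k_pair[OF assms(1), of d y] that assms(2) by auto
  from this[of a] this[of b]
  have "(\<Sum>y\<in>{a, b, c}. n - real (card (nbhd H {d, y}))) \<le> 2 * x * n + n - k {c, d}"
    using assms(2) k_pair[OF assms(1), of c d] by (simp add: algebra_simps insert_commute)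
  ultimately show ?thesis unfolding s by simp
qed

lemma k_pos:
  shows "\<lbrakk>clique H r K; 3 \<le> r; a \<in> K; b \<in> K; a \<noteq> b\<rbrakk> \<Longrightarrow> 0 < k {a, b}"
    and "\<lbrakk>clique H 3 {a, b, c}; distinct [a, b, c]\<rbrakk> \<Longrightarrow> 0 < k {a, b, c}"
    and "\<lbrakk>clique H 4 {a, b, c, d}; distinct [a, b, c, d]\<rbrakk> \<Longrightarrow> 0 < k {a, b, c, d}"
proof -
  \<comment> \<open>The worst case is a quadruple, with at least \<open>(1 - 6 * x) * n\<close>
    extensions.\<close>
  have p: "0 < (1 - 6 * x) * n" "0 \<le> x * n" using x n_pos by auto
  show "0 < k {a, b}" if "clique H r K" "3 \<le> r" "a \<in> K" "b \<in> K" "a \<noteq> b"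
    using k_pair(2)[OF that] p by (simp add: algebra_simps)
  show "0 < k {a, b, c}" if "clique H 3 {a, b, c}" "distinct [a, b, c]"
    using k_triple_ge[OF that] k_pair(2)[OF that(1), of a b] that(2) p by (simp add: algebra_simps)
  show "0 < k {a, b, c, d}" if "clique H 4 {a, b, c, d}" "distinct [a, b, c, d]"
  proof -
    have "clique H 3 {a, b, c}" using that(2) by (intro clique_mono[OF that(1)]) auto
    then show ?thesis
      using k_four_ge[OF that] k_triple_ge[of a b c] k_pair(2)[OF that(1), of a b]
        k_pair(2)[OF that(1), of c d] that(2) p by (simp add: algebra_simps)
  qed
qed

text \<open>For each fixed fourth vertex \<open>p\<close> the sum over \<open>q\<close> is already
  nonnegative: the main term pays for the losses \<open>c1\<close> and \<open>c2\<close>.\<close>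

lemma w_triple_nonneg:
  assumes abc: "distinct [a, b, c]" and edge: "{a, b, c} \<in> edges H"
  shows "0 \<le> w_triple H a b c"
proof -
  define c1 c2 where "c1 = x / ((1-x)*(1-2*x))" and "c2 = 2*x / ((1-x)*(1-4*x))"
  have c12: "c1 + c2 \<le> 1" "0 \<le> c2" using cubic_budget[OF x] x by (auto simp: c1_def c2_def)
  have cl3: "clique H 3 {a, b, c}" using edge by (rule clique_edge)
  have kab: "(1-x)*n \<le> k {a, b}" "0 < k {a, b}" using k_pair(2)[OF cl3, of a b] k_pos(1)[OF cl3, of a b] abc by auto
  have kabc: "0 < k {a, b, c}" using k_pos(2)[OF cl3 abc] .
  let ?g = "\<lambda>p q. 1 / (k {a, b} * k {a, b, c} * k {a, b, c, p})
    + (1 / k {a, b} - 1 / k {a, p}) / (k {a, b, p} * k {a, b, c, p})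
    + (1 / k {a, b} - 1 / k {a, p}) / (k {a, b, p} * k {a, b, p, q})
    + (1 / k {p, q} - 1 / k {a, p}) / (k {a, p, q} * k {a, b, p, q})"
  have "0 \<le> (\<Sum>q\<in>ext H {a, b, c, p}. ?g p q)" if p: "p \<in> ext H {a, b, c}" for p
  proof -
    have dp: "distinct [a, b, c, p]" using p abc by (auto simp: ext_def)
    have cl4: "clique H 4 {a, b, c, p}"
      using p abc by (auto simp: ext_def eval_nat_numeral insert_commute)
    have kabcp: "0 < k {a, b, c, p}" using k_pos(3)[OF cl4 dp] .
    have cl3p: "clique H 3 {a, b, p}" using dp by (intro clique_mono[OF cl4]) auto
    have K: "k {a, b} - 2*x*n \<le> k {a, b, p}" "0 < k {a, b, p}"
      using k_triple_ge[OF cl3p] k_pos(2)[OF cl3p] dp by auto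
    have kap: "(1-x)*n \<le> k {a, p}" using k_pair(2)[OF cl4, of a p] dp by auto
    have L: "1 / k {a, p} \<le> 1 / ((1-x)*n)" using kap x n_pos by (intro frac_le mult_pos_pos) auto
    have "{a, b, c, p} = insert c {a, b, p}" by auto
    then have "ext H {a, b, c, p} \<subseteq> ext H {a, b, p}"
      using ext_insert_subset[of _ c "{a, b, p}"] dp by auto
    \<comment> \<open>Keeps the \<open>c2\<close> losses, summed over all \<open>q\<close>, within
      \<open>c2 / (n * k {a, b})\<close>.\<close>
    then have le: "k {a, b, c, p} \<le> k {a, b, p}" using finite_ext by (simp add: card_mono)
    have g: "1 / (k {a, b} * k {a, b, c} * k {a, b, c, p}) - c1 / (n * k {a, b} * k {a, b, c, p})
        - c2 / (n * k {a, b} * k {a, b, p}) \<le> ?g p q" if q: "q \<in> ext H {a, b, c, p}" for q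
    proof -
      have dq: "distinct [a, b, c, p, q]" using q dp by (auto simp: ext_def)
      have cl5: "clique H 5 {a, b, c, p, q}"
        using q dp by (auto simp: ext_def eval_nat_numeral insert_commute)
      have cl4q: "clique H 4 {a, b, p, q}" using dq by (intro clique_mono[OF cl5]) auto
      have cl3q: "clique H 3 {p, q, a}" using dq by (intro clique_mono[OF cl5]) auto
      have kpq: "(1-x)*n \<le> k {p, q}" using k_pair(2)[OF cl5, of p q] dq by auto
      have M: "k {p, q} - 2*x*n \<le> k {a, p, q}" "0 < k {a, p, q}"
        using k_triple_ge[OF cl3q] k_pos(2)[OF cl3q] dq by (auto simp: insert_commute)
      have F: "k {a, b, p} + k {p, q} - n - 2*x*n \<le> k {a, b, p, q}" "0 < k {a, b, p, q}"
        using k_four_ge[OF cl4q] k_pos(3)[OF cl4q] dq by auto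
      have "(1 / k {a, p} - 1 / k {a, b}) / (k {a, b, p} * k {a, b, c, p})
          \<le> (1 / ((1-x)*n) - 1 / k {a, b}) / k {a, b, p} / k {a, b, c, p}"
        using L K kabcp by (simp add: divide_right_mono)
      also have "\<dots> \<le> c1 / (n * k {a, b}) / k {a, b, c, p}"
        unfolding c1_def using kab k_le K x n_pos by (intro divide_right_mono vertex_bound) auto
      finally have 1: "(1 / k {a, p} - 1 / k {a, b}) / (k {a, b, p} * k {a, b, c, p})
          \<le> c1 / (n * k {a, b} * k {a, b, c, p})" by simp
      \<comment> \<open>The last two summands share \<open>k {a, b, p, q}\<close> and must be
        bounded jointly: a large \<open>k {p, q}\<close> worsens one of them but enlarges this
        denominator.\<close>
      have "(1 / k {a, p} - 1 / k {a, b}) / (k {a, b, p} * k {a, b, p, q})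
          + (1 / k {a, p} - 1 / k {p, q}) / (k {a, p, q} * k {a, b, p, q})
          \<le> (1 / ((1-x)*n) - 1 / k {a, b}) / (k {a, b, p} * k {a, b, p, q})
          + (1 / ((1-x)*n) - 1 / k {p, q}) / (k {a, p, q} * k {a, b, p, q})"
        using L K M F by (intro add_mono divide_right_mono) auto
      also have "\<dots> \<le> c2 / (n * k {a, b} * k {a, b, p})"
        unfolding c2_def using x n_pos kab k_le kpq K M F by (intro pair_bound) auto
      finally have 2: "(1 / k {a, p} - 1 / k {a, b}) / (k {a, b, p} * k {a, b, p, q})
          + (1 / k {a, p} - 1 / k {p, q}) / (k {a, p, q} * k {a, b, p, q})
          \<le> c2 / (n * k {a, b} * k {a, b, p})" .
      show ?thesis using 1 2 by (simp add: diff_divide_distrib)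
    qed
    \<comment> \<open>The estimates used are \<open>k {a, b, c} \<le> n\<close> for the main term
      and \<open>le\<close> for the \<open>c2\<close> loss.\<close>
    have "0 \<le> (1 - c1 - c2) / (n * k {a, b})" using c12 kab n_pos by simp
    also have "\<dots> = 1 / (k {a, b} * n) - c1 / (n * k {a, b}) - c2 / (n * k {a, b}) * 1"
      by (simp add: diff_divide_distrib mult.commute)
    also have "\<dots> \<le> 1 / (k {a, b} * k {a, b, c}) - c1 / (n * k {a, b})
        - c2 / (n * k {a, b}) * (k {a, b, c, p} / k {a, b, p})"
      using c12 kab kabc n_pos k_le le K
      by (intro diff_mono order_refl divide_left_mono mult_left_mono mult_pos_pos) auto
    also have "\<dots> = (\<Sum>q\<in>ext H {a, b, c, p}. 1 / (k {a, b} * k {a, b, c} * k {a, b, c, p})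
        - c1 / (n * k {a, b} * k {a, b, c, p}) - c2 / (n * k {a, b} * k {a, b, p}))"
      using kabcp by (simp add: right_diff_distrib)
    also have "\<dots> \<le> (\<Sum>q\<in>ext H {a, b, c, p}. ?g p q)" by (intro sum_mono g)
    finally show ?thesis .
  qed
  then have "0 \<le> (\<Sum>p\<in>ext H {a, b, c}. \<Sum>q\<in>ext H {a, b, c, p}. ?g p q)" by (rule sum_nonneg)
  also have "\<dots> = (\<Sum>(p, q)\<in>completions a b c. ?g p q)"
    unfolding completions_eq_Sigma[OF abc] by (rule sum.Sigma) (auto simp: finite_ext)
  also have "\<dots> = 6 * w_triple H a b c" unfolding w_triple_eq[OF abc] by simp
  finally show ?thesis by simp
qed

text \<open>The two orders of the pair contribute total weight 1 each, which the factor 1/2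
  averages.\<close>

lemma weighted_codeg_w_edge_eq_1:
  assumes "e \<in> edges H" "y \<in> e" "z \<in> e" "y \<noteq> z"
  shows "weighted_codeg H (w_edge H) {y, z} = 1"
proof -
  have cle: "clique H 3 e" using assms(1) by (rule clique_edge)
  have sum1: "(\<Sum>vs\<in>{vs\<in>ordered_5cliques H. vs ! 0 = u \<and> vs ! 1 = v}. W H (take 4 vs)) = 1"
    if uv: "u \<in> e" "v \<in> e" "u \<noteq> v" for u v
  proof (rule sum_W_starting_with[OF uv(3)])
    have "0 < k {u, v}" using k_pos(1)[OF cle _ uv] by simp
    then show "ext H {u, v} \<noteq> {}" by auto
  next
    fix c assume "c \<in> ext H {u, v}"
    then have "clique H 3 {u, v, c}" and d: "distinct [u, v, c]"
      using uv(3) by (auto simp: ext_def eval_nat_numeral insert_commute)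
    then have "0 < k {u, v, c}" by (rule k_pos(2))
    then show "ext H {u, v, c} \<noteq> {}" by auto
    fix d assume "d \<in> ext H {u, v, c}"
    then have "clique H 4 {u, v, c, d}" "distinct [u, v, c, d]"
      using d by (auto simp: ext_def eval_nat_numeral insert_commute)
    then have "0 < k {u, v, c, d}" by (rule k_pos(3))
    then show "ext H {u, v, c, d} \<noteq> {}" by auto
  qed
  have "{vs\<in>ordered_5cliques H. {y, z} = {vs ! 0, vs ! 1}}
      = {vs\<in>ordered_5cliques H. vs ! 0 = y \<and> vs ! 1 = z} \<union> {vs\<in>ordered_5cliques H. vs ! 0 = z \<and> vs ! 1 = y}"
    by (auto simp: doubleton_eq_iff)
  moreover have "(\<Sum>vs\<in>\<dots>. W H (take 4 vs)) = 1 + 1"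
    using finite_ordered_5cliques assms
    by (subst sum.union_disjoint) (auto simp: sum1 simp del: One_nat_def)
  ultimately show ?thesis
    using weighted_codeg_w_edge[of "{y, z}"] assms(4) by simp
qed

lemma perfect_fractional_STS_w_edge: "perfect_fractional_STS H (w_edge H)"
proof -
  have nonneg: "0 \<le> w_edge H e" if "e \<in> edges H" for e
    using that uniform by (intro w_edge_nonneg w_triple_nonneg) (auto simp: three_uniform_def)
  have finE: "finite (edges H)"
    using uniform by (intro finite_subset[of "edges H" "Pow (vertices H)"]) (auto simp: three_uniform_def)
  \<comment> \<open>The weight is one term of a sum of nonnegative terms equal to 1.\<close>
  have "w_edge H e \<le> 1" if e: "e \<in> edges H" for e
  proof -
    have "card e = 3" using e uniform by (auto simp: three_uniform_def)
    then obtain a b c where "e = {a, b, c}" "a \<noteq> b" by (auto simp: card_3_iff)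
    then have ab: "a \<in> e" "b \<in> e" "a \<noteq> b" by auto
    have "w_edge H e \<le> weighted_codeg H (w_edge H) {a, b}"
      unfolding weighted_codeg_def using e ab finE nonneg by (intro member_le_sum) auto
    then show ?thesis using weighted_codeg_w_edge_eq_1[OF e ab] by simp
  qed
  moreover have "weighted_codeg H (w_edge H) p = 1" if "p \<in> shadow H" for p
  proof -
    have "card p = 2" "nbhd H p \<noteq> {}" using that by (auto simp: shadow_def codeg_def)
    then obtain a b v where "p = {a, b}" "a \<noteq> b" "p \<union> {v} \<in> edges H"
      by (auto simp: card_2_iff nbhd_def)
    then show ?thesis using weighted_codeg_w_edge_eq_1[of "p \<union> {v}" a b] by auto
  qed
  ultimately show ?thesis using nonneg by (auto simp: perfect_fractional_STS_def)
qed

end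

theorem theorem3p2:
  fixes H :: "'a hypergraph"
  assumes "three_uniform H"
    and "card (vertices H) \<ge> 5"
    and "real (min_ess_codeg H) \<ge> (1 - xstar) * real (card (vertices H))"
  shows "(\<forall>x1 x2 x3. distinct [x1, x2, x3] \<and> {x1, x2, x3} \<in> edges H \<longrightarrow> w_triple H x1 x2 x3 \<ge> 0)
    \<and> perfect_fractional_STS H (w_edge H)"
proof -
  \<comment> \<open>The value is 5/54; it excludes the endpoint, where the bound on quadruples would
    degenerate.\<close>
  have "cubic (1/6) \<noteq> 0" by (simp add: cubic_def power_divide)
  then have "xstar \<noteq> 1/6" using xstar_root(2) by metis
  then have x: "0 \<le> xstar" "xstar < 1/6" "cubic xstar \<le> 0"
    using xstar_root by auto
  interpret uniform_hypergraph H by unfold_locales (rule assms(1))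
  interpret dense_hypergraph H xstar
  proof
    \<comment> \<open>The third vertex of \<open>e\<close> puts \<open>{a, b}\<close> into the
      shadow, so the minimum bounds its codegree.\<close>
    fix e a b assume e: "e \<in> edges H" "a \<in> e" "b \<in> e" "a \<noteq> b"
    have V: "e \<subseteq> vertices H" "card e = 3" using assms(1) e by (auto simp: three_uniform_def)
    then have "card (e - {a, b}) = 1" using e by (subst card_Diff_subset) auto
    then obtain c where "e - {a, b} = {c}" by (auto simp: card_1_singleton_iff)
    then have "{a, b} \<union> {c} = e" using e by auto
    then have "c \<in> nbhd H {a, b}" using e by (simp add: nbhd_def)
    moreover have "finite (nbhd H {a, b})"
      using nbhd_subset_vertices finite_vertices by (rule finite_subset)
    ultimately have "{a, b} \<in> shadow H"
      using e V by (auto simp: shadow_def codeg_def card_gt_0_iff)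
    moreover have "finite (shadow H)"
      using finite_vertices by (intro finite_subset[of "shadow H" "Pow (vertices H)"]) (auto simp: shadow_def)
    ultimately have "min_ess_codeg H \<le> codeg H {a, b}" by (simp add: min_ess_codeg_def)
    then show "(1 - xstar) * real (card (vertices H)) \<le> real (codeg H {a, b})"
      using assms(3) by linarith
  qed (use assms x in auto)
  show ?thesis using w_triple_nonneg perfect_fractional_STS_w_edge by blast
qed

end
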